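(* Let $K$ be a field and let $X$ be a minimal subshift over a finite alphabet, with associated monomial algebra $A_X$ over $K$. Then every (left or right) $A_X$-module is exhaustively amenable.
   Context: Algebras are associative and unital. Let $\Sigma=\{x_1,\dots,x_d\}$ be a finite alphabet. A subshift $X\subseteq\Sigma^{\mathbb Z}$ is a non-empty closed, shift-invariant subset (product topology, $\Sigma$ discrete); it is minimal if it contains no non-empty proper subshift. A factor of $X$ is a finite word occurring as a contiguous subword of some element of $X$. The monomial algebra $A_X$ over $K$ is spanned by the finite factors of $X$ (including the empty word $1$), which form a basis, with multiplication given by concatenation, where a product of factors is set to be $0$ if the concatenated word is not a factor of $X$. Let $A$ be a $K$-algebra and $M$ a right $A$-module. For a finite-dimensional subspace $V\leq A$ and $\varepsilon>0$, a finite-dimensional subspace $L\leq M$ is $(V,\varepsilon)$-invariant if $\dim_K LV<(1+\varepsilon)\dim_K L$, where $LV$ is the span of all products $\ell v$, $\ell\in L$, $v\in V$. The module $M$ is exhaustively amenable if for every finite-dimensional subspace $V\leq A$, every $\varepsilon>0$ and every finite-dimensional subspace $W\leq M$ there is a $(V,\varepsilon)$-invariant subspace of $M$ containing $W$. For left modules the notions are defined analogously, with $VL$ in place of $LV$.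
   Formalization: The modules are assumed nonzero: the zero module has only the subspace L = 0, for which the strict inequality dim LV < (1+ε) dim L reads 0 < 0, so it is not exhaustively amenable under the stated definition. *)

theory Defs
  imports "HOL-Analysis.Analysis" "HOL-Library.Poly_Mapping"
begin

section \<open>Subshifts and their factors\<close>

definition shift :: "(int \<Rightarrow> 'a) \<Rightarrow> (int \<Rightarrow> 'a)" where
  "shift x = (\<lambda>i. x (i + 1))"

definition subshift :: "'a set \<Rightarrow> (int \<Rightarrow> 'a) set \<Rightarrow> bool" where
  "subshift \<Sigma> X \<longleftrightarrow>
     X \<noteq> {} \<and>
     closedin (product_topology (\<lambda>_. discrete_topology \<Sigma>) UNIV) X \<and>
     shift ` X = X"

definition minimal_subshift :: "'a set \<Rightarrow> (int \<Rightarrow> 'a) set \<Rightarrow> bool" where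
  "minimal_subshift \<Sigma> X \<longleftrightarrow>
     subshift \<Sigma> X \<and> (\<forall>Y. subshift \<Sigma> Y \<and> Y \<subseteq> X \<longrightarrow> Y = X)"

definition factors :: "(int \<Rightarrow> 'a) set \<Rightarrow> 'a list set" where
  "factors X = {w. \<exists>x\<in>X. \<exists>i. w = map (\<lambda>j. x (i + int j)) [0..<length w]}"


section \<open>Algebras and modules over them\<close>

text \<open>
  The underlying vector space of an algebra is a subspace \<open>A\<close> of an ambient vector space (so that
  an algebra may depend on parameters such as a subshift). The multiplication only matters on \<open>A\<close>.
  Algebras need not be commutative.
\<close>

locale unital_algebra = alg: vector_space scaleA
  for scaleA :: "'k::field \<Rightarrow> 'b::ab_group_add \<Rightarrow> 'b" +
  fixes A :: "'b set"
    and mult :: "'b \<Rightarrow> 'b \<Rightarrow> 'b"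
    and one :: 'b
  assumes subspace_A: "alg.subspace A"
    and one_closed: "one \<in> A"
    and mult_closed: "\<lbrakk>a \<in> A; b \<in> A\<rbrakk> \<Longrightarrow> mult a b \<in> A"
    and mult_assoc: "\<lbrakk>a \<in> A; b \<in> A; c \<in> A\<rbrakk> \<Longrightarrow> mult (mult a b) c = mult a (mult b c)"
    and mult_one_left: "a \<in> A \<Longrightarrow> mult one a = a"
    and mult_one_right: "a \<in> A \<Longrightarrow> mult a one = a"
    and mult_add_left: "\<lbrakk>a \<in> A; b \<in> A; c \<in> A\<rbrakk> \<Longrightarrow> mult (a + b) c = mult a c + mult b c"
    and mult_add_right: "\<lbrakk>a \<in> A; b \<in> A; c \<in> A\<rbrakk> \<Longrightarrow> mult a (b + c) = mult a b + mult a c"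
    and mult_scale_left: "\<lbrakk>a \<in> A; b \<in> A\<rbrakk> \<Longrightarrow> mult (scaleA r a) b = scaleA r (mult a b)"
    and mult_scale_right: "\<lbrakk>a \<in> A; b \<in> A\<rbrakk> \<Longrightarrow> mult a (scaleA r b) = scaleA r (mult a b)"

text \<open>The underlying set of a module is the whole type \<open>'m\<close>.\<close>

locale right_module =
  unital_algebra scaleA A mult one + M: vector_space scaleM
  for scaleA :: "'k::field \<Rightarrow> 'b::ab_group_add \<Rightarrow> 'b"
    and A mult one
    and scaleM :: "'k \<Rightarrow> 'm::ab_group_add \<Rightarrow> 'm" +
  fixes act :: "'m \<Rightarrow> 'b \<Rightarrow> 'm"
  assumes act_one: "act m one = m"
    and act_mult: "\<lbrakk>a \<in> A; b \<in> A\<rbrakk> \<Longrightarrow> act m (mult a b) = act (act m a) b"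
    and act_add_left: "a \<in> A \<Longrightarrow> act (m + n) a = act m a + act n a"
    and act_add_right: "\<lbrakk>a \<in> A; b \<in> A\<rbrakk> \<Longrightarrow> act m (a + b) = act m a + act m b"
    and act_scale_left: "a \<in> A \<Longrightarrow> act (scaleM r m) a = scaleM r (act m a)"
    and act_scale_right: "a \<in> A \<Longrightarrow> act m (scaleA r a) = scaleM r (act m a)"

locale left_module =
  unital_algebra scaleA A mult one + M: vector_space scaleM
  for scaleA :: "'k::field \<Rightarrow> 'b::ab_group_add \<Rightarrow> 'b"
    and A mult one
    and scaleM :: "'k \<Rightarrow> 'm::ab_group_add \<Rightarrow> 'm" +
  fixes act :: "'b \<Rightarrow> 'm \<Rightarrow> 'm"
  assumes act_one: "act one m = m"
    and act_mult: "\<lbrakk>a \<in> A; b \<in> A\<rbrakk> \<Longrightarrow> act (mult a b) m = act a (act b m)"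
    and act_add_left: "\<lbrakk>a \<in> A; b \<in> A\<rbrakk> \<Longrightarrow> act (a + b) m = act a m + act b m"
    and act_add_right: "a \<in> A \<Longrightarrow> act a (m + n) = act a m + act a n"
    and act_scale_left: "a \<in> A \<Longrightarrow> act (scaleA r a) m = scaleM r (act a m)"
    and act_scale_right: "a \<in> A \<Longrightarrow> act a (scaleM r m) = scaleM r (act a m)"


section \<open>Exhaustive amenability\<close>

context vector_space
begin

definition fin_dim_subspace :: "'b set \<Rightarrow> bool" where
  "fin_dim_subspace L \<longleftrightarrow> subspace L \<and> (\<exists>B. finite B \<and> span B = L)"

end

context right_module
begin

definition invariant_subspace :: "'b set \<Rightarrow> real \<Rightarrow> 'm set \<Rightarrow> bool" where
  "invariant_subspace V \<epsilon> L \<longleftrightarrow>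
     M.fin_dim_subspace L \<and>
     real (M.dim (M.span {act l v | l v. l \<in> L \<and> v \<in> V})) < (1 + \<epsilon>) * real (M.dim L)"

definition exhaustively_amenable :: bool where
  "exhaustively_amenable \<longleftrightarrow>
     (\<forall>V \<epsilon> W. alg.fin_dim_subspace V \<and> V \<subseteq> A \<and> \<epsilon> > 0 \<and> M.fin_dim_subspace W \<longrightarrow>
        (\<exists>L. W \<subseteq> L \<and> invariant_subspace V \<epsilon> L))"

text \<open>
  The inequality defining invariance is strict, hence it fails for \<open>L = {0}\<close>, and the zero module
  is not exhaustively amenable.
\<close>

lemma zero_module_not_exhaustively_amenable:
  assumes "(UNIV :: 'm set) = {0}"
  shows "\<not> exhaustively_amenable"
proof
  assume *: exhaustively_amenable
  have "alg.fin_dim_subspace {0}"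
    unfolding alg.fin_dim_subspace_def by (auto intro!: exI[of _ "{}"])
  moreover have "M.fin_dim_subspace {0}"
    unfolding M.fin_dim_subspace_def by (auto intro!: exI[of _ "{}"])
  moreover have "{0} \<subseteq> A" using subspace_A alg.subspace_0 by auto
  ultimately obtain L where L: "invariant_subspace {0} 1 L"
    using *[unfolded exhaustively_amenable_def, rule_format, of "{0}" 1 "{0}"] by auto
  have "M.subspace L"
    using L by (simp add: invariant_subspace_def M.fin_dim_subspace_def)
  hence "0 \<in> L" by (rule M.subspace_0)
  moreover have "L \<subseteq> {0}" using assms by auto
  ultimately have "L = M.span {}" by auto
  hence "M.dim L = 0" using M.dim_eq_card[of "{}" L] M.independent_empty by simp
  with L show False by (simp add: invariant_subspace_def)
qed

end

context left_module
begin

definition invariant_subspace :: "'b set \<Rightarrow> real \<Rightarrow> 'm set \<Rightarrow> bool" where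
  "invariant_subspace V \<epsilon> L \<longleftrightarrow>
     M.fin_dim_subspace L \<and>
     real (M.dim (M.span {act v l | v l. v \<in> V \<and> l \<in> L})) < (1 + \<epsilon>) * real (M.dim L)"

definition exhaustively_amenable :: bool where
  "exhaustively_amenable \<longleftrightarrow>
     (\<forall>V \<epsilon> W. alg.fin_dim_subspace V \<and> V \<subseteq> A \<and> \<epsilon> > 0 \<and> M.fin_dim_subspace W \<longrightarrow>
        (\<exists>L. W \<subseteq> L \<and> invariant_subspace V \<epsilon> L))"

end


section \<open>The monomial algebra of a subshift\<close>

text \<open>
  Formal \<open>'k\<close>-linear combinations of words are finitely supported functions
  \<open>'a list \<Rightarrow>\<^sub>0 'k\<close>; the word \<open>w\<close> is \<open>Poly_Mapping.single w 1\<close>.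
\<close>

definition word_scale :: "'k::field \<Rightarrow> ('a list \<Rightarrow>\<^sub>0 'k) \<Rightarrow> ('a list \<Rightarrow>\<^sub>0 'k)" where
  "word_scale c f = Poly_Mapping.map (\<lambda>r. c * r) f"

definition monomial_algebra :: "(int \<Rightarrow> 'a) set \<Rightarrow> ('a list \<Rightarrow>\<^sub>0 'k::field) set" where
  "monomial_algebra X = {f. Poly_Mapping.keys f \<subseteq> factors X}"

definition monomial_mult ::
    "(int \<Rightarrow> 'a) set \<Rightarrow> ('a list \<Rightarrow>\<^sub>0 'k::field) \<Rightarrow> ('a list \<Rightarrow>\<^sub>0 'k) \<Rightarrow> ('a list \<Rightarrow>\<^sub>0 'k)" where
  "monomial_mult X f g =
     (\<Sum>u\<in>Poly_Mapping.keys f. \<Sum>v\<in>Poly_Mapping.keys g.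
        if u @ v \<in> factors X
        then Poly_Mapping.single (u @ v) (Poly_Mapping.lookup f u * Poly_Mapping.lookup g v)
        else 0)"

definition monomial_one :: "'a list \<Rightarrow>\<^sub>0 'k::field" where
  "monomial_one = Poly_Mapping.single [] 1"

lemma lookup_word_scale: "Poly_Mapping.lookup (word_scale c f) w = c * Poly_Mapping.lookup f w"
  by (simp add: word_scale_def Poly_Mapping.map.rep_eq when_def)

lemma vector_space_word_scale: "vector_space (word_scale :: 'k::field \<Rightarrow> ('a list \<Rightarrow>\<^sub>0 'k) \<Rightarrow> _)"
  by unfold_locales
     (auto intro!: poly_mapping_eqI simp: lookup_word_scale lookup_add algebra_simps)

lemma Nil_in_factors: "X \<noteq> {} \<Longrightarrow> [] \<in> factors X"
  by (auto simp: factors_def)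

lemma factors_alt:
  "w \<in> factors X \<longleftrightarrow> (\<exists>x\<in>X. \<exists>i. \<forall>j<length w. w ! j = x (i + int j))"
  proof -
  have "w = map (\<lambda>j. x (i + int j)) [0..<length w] \<longleftrightarrow> (\<forall>j<length w. w ! j = x (i + int j))" for x i
    by (subst list_eq_iff_nth_eq) simp
  thus ?thesis by (simp add: factors_def)
qed

lemma factors_appendD:
  assumes "u @ v \<in> factors X"
  shows "u \<in> factors X" "v \<in> factors X"
proof -
  obtain x i where x: "x \<in> X" "\<forall>j<length (u @ v). (u @ v) ! j = x (i + int j)"
    using assms unfolding factors_alt by blast
  have "\<forall>j<length u. u ! j = x (i + int j)"
    using x(2) by (metis nth_append length_append trans_less_add1)
  thus "u \<in> factors X" unfolding factors_alt using x(1) by blast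
  have "v ! j = x ((i + int (length u)) + int j)" if "j < length v" for j
    using x(2)[rule_format, of "length u + j"] that by (simp add: add.assoc)
  thus "v \<in> factors X" unfolding factors_alt using x(1) by blast
qed

lemma monomial_mult_superset:
  fixes f g :: "'a list \<Rightarrow>\<^sub>0 'k::field"
  assumes "finite U" "finite V" "Poly_Mapping.keys f \<subseteq> U" "Poly_Mapping.keys g \<subseteq> V"
  shows "monomial_mult X f g =
     (\<Sum>u\<in>U. \<Sum>v\<in>V. if u @ v \<in> factors X
        then Poly_Mapping.single (u @ v) (Poly_Mapping.lookup f u * Poly_Mapping.lookup g v) else 0)"
proof -
  have inner: "(\<Sum>v\<in>Poly_Mapping.keys g. if u @ v \<in> factors X
        then Poly_Mapping.single (u @ v) (Poly_Mapping.lookup f u * Poly_Mapping.lookup g v) else 0) =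
     (\<Sum>v\<in>V. if u @ v \<in> factors X
        then Poly_Mapping.single (u @ v) (Poly_Mapping.lookup f u * Poly_Mapping.lookup g v) else 0)" for u
    by (rule sum.mono_neutral_left) (use assms in \<open>auto simp: in_keys_iff\<close>)
  show ?thesis unfolding monomial_mult_def inner
    by (rule sum.mono_neutral_left) (use assms in \<open>auto simp: in_keys_iff intro!: sum.neutral\<close>)
qed

lemma monomial_mult_single:
  "monomial_mult X (Poly_Mapping.single u a) (Poly_Mapping.single v b) =
     (if u @ v \<in> factors X then Poly_Mapping.single (u @ v) (a * b) else 0)"
  by (subst monomial_mult_superset[of "{u}" "{v}"]) auto

lemma monomial_mult_add_left:
  "monomial_mult X (f + g) h = monomial_mult X f h + monomial_mult X g h"
proof -
  let ?U = "Poly_Mapping.keys f \<union> Poly_Mapping.keys g" and ?V = "Poly_Mapping.keys h"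
  have k: "Poly_Mapping.keys (f + g) \<subseteq> ?U" by (rule keys_add)
  show ?thesis
    by (subst (1 2 3) monomial_mult_superset[of ?U ?V])
       (use k in \<open>auto simp: lookup_add algebra_simps single_add sum.distrib[symmetric]
          intro!: sum.cong\<close>)
qed

lemma monomial_mult_add_right:
  "monomial_mult X h (f + g) = monomial_mult X h f + monomial_mult X h g"
proof -
  let ?U = "Poly_Mapping.keys f \<union> Poly_Mapping.keys g" and ?V = "Poly_Mapping.keys h"
  have k: "Poly_Mapping.keys (f + g) \<subseteq> ?U" by (rule keys_add)
  show ?thesis
    by (subst (1 2 3) monomial_mult_superset[of ?V ?U])
       (use k in \<open>auto simp: lookup_add algebra_simps single_add sum.distrib[symmetric]
          intro!: sum.cong\<close>)
qed

lemma monomial_mult_zero [simp]: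
  "monomial_mult X 0 f = 0" "monomial_mult X f 0 = 0"
  by (simp_all add: monomial_mult_def)

lemma word_scale_sum: "word_scale r (sum f I) = (\<Sum>i\<in>I. word_scale r (f i))"
  by (rule poly_mapping_eqI) (simp add: lookup_word_scale lookup_sum sum_distrib_left)

lemma word_scale_single:
  "word_scale r (Poly_Mapping.single w a) = Poly_Mapping.single w (r * a)"
  by (rule poly_mapping_eqI) (simp add: lookup_word_scale lookup_single when_def)

lemma word_scale_zero [simp]: "word_scale r 0 = 0"
  by (rule poly_mapping_eqI) (simp add: lookup_word_scale)

lemma keys_word_scale: "Poly_Mapping.keys (word_scale r f) \<subseteq> Poly_Mapping.keys f"
  by (auto simp: in_keys_iff lookup_word_scale)

lemma monomial_mult_scale_left:
  "monomial_mult X (word_scale r f) g = word_scale r (monomial_mult X f g)"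
  by (subst (1 2) monomial_mult_superset[of "Poly_Mapping.keys f" "Poly_Mapping.keys g"])
     (use keys_word_scale in \<open>auto simp: lookup_word_scale word_scale_sum word_scale_single
        mult.assoc intro!: sum.cong\<close>)

lemma monomial_mult_scale_right:
  "monomial_mult X f (word_scale r g) = word_scale r (monomial_mult X f g)"
  by (subst (1 2) monomial_mult_superset[of "Poly_Mapping.keys f" "Poly_Mapping.keys g"])
     (use keys_word_scale in \<open>auto simp: lookup_word_scale word_scale_sum word_scale_single
        mult.left_commute intro!: sum.cong\<close>)

lemma word_expansion:
  fixes f :: "'a list \<Rightarrow>\<^sub>0 'k::field"
  shows "f = (\<Sum>w\<in>Poly_Mapping.keys f. Poly_Mapping.single w (Poly_Mapping.lookup f w))"
  by (rule poly_mapping_eqI)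
     (auto simp: lookup_sum lookup_single when_def in_keys_iff)

lemma word_induct [case_names zero single add]:
  fixes f :: "'a list \<Rightarrow>\<^sub>0 'k::field"
  assumes "P 0"
    and "\<And>w a. w \<in> Poly_Mapping.keys f \<Longrightarrow> P (Poly_Mapping.single w a)"
    and "\<And>g h. P g \<Longrightarrow> P h \<Longrightarrow> P (g + h)"
  shows "P f"
proof -
  have "P (\<Sum>w\<in>S. Poly_Mapping.single w (Poly_Mapping.lookup f w))"
    if "finite S" "S \<subseteq> Poly_Mapping.keys f" for S
    using that by (induction S rule: finite_induct) (auto intro: assms)
  from this[OF finite_keys order_refl] show ?thesis by (simp only: word_expansion[symmetric])
qed

lemma monomial_mult_assoc:
  "monomial_mult X (monomial_mult X f g) h = monomial_mult X f (monomial_mult X g h)"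
proof (induction f rule: word_induct)
  case (single u a)
  show ?case
  proof (induction g rule: word_induct)
    case (single v b)
    show ?case
    proof (induction h rule: word_induct)
      case (single w c)
      show ?case
        using factors_appendD[of "u @ v" w X] factors_appendD[of u "v @ w" X]
        by (auto simp: monomial_mult_single mult.assoc)
    qed (auto simp: monomial_mult_add_right)
  qed (auto simp: monomial_mult_add_right monomial_mult_add_left)
qed (auto simp: monomial_mult_add_left)

lemma unital_algebra_monomial_algebra:
  fixes X :: "(int \<Rightarrow> 'a) set"
  assumes "X \<noteq> {}"
  shows "unital_algebra (word_scale :: 'k::field \<Rightarrow> _)
           (monomial_algebra X) (monomial_mult X) monomial_one"
proof -
  interpret V: vector_space "word_scale :: 'k \<Rightarrow> ('a list \<Rightarrow>\<^sub>0 'k) \<Rightarrow> _"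
    by (rule vector_space_word_scale)
  show ?thesis
  proof
    show sub: "V.subspace (monomial_algebra X)"
      unfolding V.subspace_def monomial_algebra_def
      by (auto dest!: subsetD[OF keys_add] subsetD[OF keys_word_scale])
    show "monomial_one \<in> monomial_algebra X"
      using Nil_in_factors[OF assms] by (simp add: monomial_one_def monomial_algebra_def)
    show "monomial_mult X a b \<in> monomial_algebra X" for a b :: "'a list \<Rightarrow>\<^sub>0 'k"
      unfolding monomial_mult_def
      by (intro V.subspace_sum[OF sub]) (auto simp: monomial_algebra_def)
    show "monomial_mult X monomial_one a = a"
      if "a \<in> monomial_algebra X" for a :: "'a list \<Rightarrow>\<^sub>0 'k"
    proof (induction a rule: word_induct)
      case (single w c)
      thus ?case using that
        by (auto simp: monomial_one_def monomial_mult_single monomial_algebra_def)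
    qed (auto simp: monomial_mult_add_right)
    show "monomial_mult X a monomial_one = a"
      if "a \<in> monomial_algebra X" for a :: "'a list \<Rightarrow>\<^sub>0 'k"
    proof (induction a rule: word_induct)
      case (single w c)
      thus ?case using that
        by (auto simp: monomial_one_def monomial_mult_single monomial_algebra_def)
    qed (auto simp: monomial_mult_add_left)
  qed (auto simp: monomial_mult_assoc monomial_mult_add_left monomial_mult_add_right
         monomial_mult_scale_left monomial_mult_scale_right)
qed

end

theory Submission
  imports Defs "HOL-Library.Sublist"
begin

text \<open>
  A module over the monomial algebra is a vector space on which the letters act by linear maps such
  that words that are not factors of \<open>X\<close> act as zero. Finitely many elements of the algebra involve
  only words of bounded length \<open>n\<close>. On an infinite-dimensional module it is enough to find subspaces
  \<open>L\<close> of arbitrarily large dimension whose images under these words lie in a space of dimension at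
  most \<open>dim L + n\<close>: adding a prescribed \<open>W\<close> to \<open>L\<close> costs a constant, which is negligible when
  \<open>dim L\<close> is large (\<open>almost_invariant_superspace\<close>). A finite-dimensional nonzero module is its own
  invariant subspace.

  The branching of the factors seems to be an obstacle, as their number may grow exponentially.
  The decisive point is that it disappears along suitable long paths. Fix a vector \<open>m\<close> and consider
  the words \<open>w\<close> with \<open>m w\<close> nonzero, as a tree. By minimality each factor \<open>u\<close> occurs in all
  sufficiently long words, so there is a deepest node that avoids \<open>u\<close>. Its last letters are those of
  \<open>u\<close> but one, and there \<open>u\<close> is completed by every possible continuation. Every branch off the path
  \<open>u\<close> just traversed must therefore meet another occurrence of \<open>u\<close>, which overlaps the part before
  the path. Overlaps are sparse unless long words have small periods, so for long \<open>u\<close> there are too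
  few branch points to interrupt all stretches of length \<open>N\<close>. If long words do have small periods,
  recurrence makes all words periodic, and there is no branching beyond the period. Hence arbitrarily
  long non-branching paths exist (\<open>long_nonbranching_path\<close>).

  Along such a path the vectors \<open>m, m y\<^sub>1, m y\<^sub>1 y\<^sub>2, \<dots>\<close> span spaces that each letter enlarges by at
  most one dimension. If the dimension once fails to increase, the span is a finite-dimensional
  submodule. To profit from both alternatives, the argument runs modulo a finite-dimensional
  submodule of maximal dimension; if there is none, the finite-dimensional submodules themselves are
  the required subspaces (\<open>unbounded_almost_invariant\<close>).
\<close>

section \<open>Periods and uniformly recurrent languages\<close>

text \<open>
  Words of length at most \<open>d\<close> have period \<open>d\<close> for trivial reasons; the notion is informative only for
  words that are long compared to \<open>d\<close>.
\<close>

definition has_period :: "nat \<Rightarrow> 'a list \<Rightarrow> bool" where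
  "has_period d v \<longleftrightarrow> (\<forall>t. t + d < length v \<longrightarrow> v ! t = v ! (t + d))"

lemma has_period_multiple:
  assumes "has_period d v"
  shows "has_period (k * d) v"
proof (induction k)
  case (Suc k)
  show ?case
    unfolding has_period_def
  proof (intro allI impI)
    fix t assume t: "t + Suc k * d < length v"
    hence "v ! t = v ! (t + k * d)"
      using Suc unfolding has_period_def by auto
    also have "\<dots> = v ! (t + k * d + d)"
      using assms t unfolding has_period_def by (simp add: algebra_simps)
    finally show "v ! t = v ! (t + Suc k * d)" by (simp add: algebra_simps)
  qed
qed (simp add: has_period_def)

lemma has_period_sublist:
  assumes "has_period d w" "sublist v w"
  shows "has_period d v"
  unfolding has_period_def
proof (intro allI impI)
  fix t assume t: "t + d < length v"
  obtain a b where w: "w = a @ v @ b" using assms(2) unfolding sublist_def by blast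
  have "w ! (length a + t) = w ! (length a + t + d)"
    using assms(1)[unfolded has_period_def, rule_format, of "length a + t"] t by (simp add: w)
  moreover have "w ! (length a + t) = v ! t" "w ! (length a + (t + d)) = v ! (t + d)"
    using t unfolding w nth_append_length_plus by (simp_all add: nth_append)
  ultimately show "v ! t = v ! (t + d)" by (simp add: add.assoc)
qed

text \<open>
  Two prefixes of \<open>u\<close> that both end where \<open>w\<close> ends are the same stretch of letters read with a
  delay of \<open>j - i\<close>, so the longer one repeats itself after \<open>j - i\<close> letters.
\<close>

lemma overlaps_period:
  assumes "suffix (take i u) w" "suffix (take j u) w" "i \<le> j" "j \<le> length u"
  shows "has_period (j - i) (take j u)"
  unfolding has_period_def
proof (intro allI impI)
  fix t assume t: "t + (j - i) < length (take j u)"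
  obtain a where a: "w = a @ take i u" using assms(1) unfolding suffix_def by blast
  obtain b where b: "w = b @ take j u" using assms(2) unfolding suffix_def by blast
  have "length a = length b + (j - i)"
    using arg_cong[OF a, of length] arg_cong[OF b, of length] assms(3,4) by simp
  hence "w ! (length a + t) = (b @ take j u) ! (length b + (t + (j - i)))"
    using b by (simp add: algebra_simps)
  also have "\<dots> = take j u ! (t + (j - i))" by (rule nth_append_length_plus)
  finally show "take j u ! t = take j u ! (t + (j - i))"
    using a t assms(3,4) by simp
qed

text \<open>
  The two axioms are what remains of minimality of a subshift. They are stated for a bare set of
  words because they are invariant under reversing all words, and reversal exchanges left and right
  modules.
\<close>

locale uniformly_recurrent =
  fixes F :: "'a list set"
  assumes sublist_closed: "\<lbrakk>w \<in> F; sublist v w\<rbrakk> \<Longrightarrow> v \<in> F"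
    and recurrent: "u \<in> F \<Longrightarrow> \<exists>R. \<forall>w\<in>F. R \<le> length w \<longrightarrow> sublist u w"
begin

lemma periodic_if_long_periodic:
  assumes "\<And>n. \<exists>w\<in>F. n \<le> length w \<and> has_period q w" and "v \<in> F"
  shows "has_period q v"
  using recurrent[OF \<open>v \<in> F\<close>] assms(1) has_period_sublist by metis

end

section \<open>Non-branching paths in trees of words\<close>

text \<open>
  Words form a tree in which the children of \<open>w\<close> are the words \<open>w @ [x]\<close>. In the application,
  \<open>P w\<close> says that \<open>w\<close> does not carry a fixed vector into a fixed submodule; a leaf would give a
  vector that every letter carries into the submodule, which is an easier situation.
\<close>

locale leafless_subtree = uniformly_recurrent F for F :: "'a list set" +
  fixes P :: "'a list \<Rightarrow> bool"
  assumes root: "P []"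
    and parent: "P (w @ [x]) \<Longrightarrow> P w"
    and child: "P w \<Longrightarrow> \<exists>x. P (w @ [x])"
    and in_language: "P w \<Longrightarrow> w \<in> F"
begin

lemma prefix_closed: "P (w @ z) \<Longrightarrow> P w"
proof (induction z rule: rev_induct)
  case (snoc x z)
  thus ?case using parent[of "w @ z" x] by simp
qed simp

lemma extension: "P w \<Longrightarrow> \<exists>z. length z = k \<and> P (w @ z)"
proof (induction k)
  case (Suc k)
  then obtain z where "length z = k" "P (w @ z)" by blast
  moreover then obtain x where "P ((w @ z) @ [x])" using child by blast
  ultimately show ?case by (intro exI[of _ "z @ [x]"]) simp
qed simp

definition nonbranching :: "'a list \<Rightarrow> 'a list \<Rightarrow> bool" where
  "nonbranching w z \<longleftrightarrow> P (w @ z) \<and> (\<forall>i<length z. \<forall>x. P (w @ take i z @ [x]) \<longrightarrow> x = z ! i)"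

text \<open>
  If all words have period \<open>q\<close>, then a word of length at least \<open>q\<close> determines its next letter,
  so that the tree does not branch at all below depth \<open>q\<close>.
\<close>

lemma nonbranching_if_periodic:
  assumes "\<And>v. v \<in> F \<Longrightarrow> has_period q v" "q > 0"
  shows "\<exists>w z. length z = N \<and> nonbranching w z"
proof -
  obtain w where w: "length w = q" "P w" using extension[OF root, of q] by auto
  obtain z where z: "length z = N" "P (w @ z)" using extension[OF w(2)] by blast
  have "x = z ! i" if i: "i < length z" and x: "P (w @ take i z @ [x])" for i x
  proof -
    let ?v = "w @ z" and ?v' = "w @ take i z @ [x]"
    have "?v' ! i = ?v' ! (i + q)" "?v ! i = ?v ! (i + q)"
      using assms(1)[OF in_language[OF x]] assms(1)[OF in_language[OF z(2)]] i w
      unfolding has_period_def by auto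
    moreover have "?v' ! (i + q) = x" "?v ! (i + q) = z ! i"
      using i w by (auto simp: nth_append)
    moreover have "?v' ! i = ?v ! i" using i w assms(2) by (auto simp: nth_append)
    ultimately show ?thesis by simp
  qed
  thus ?thesis using z unfolding nonbranching_def by blast
qed

text \<open>
  Below \<open>w'\<close>, every path of length \<open>length u\<close> must meet an occurrence of \<open>u\<close>, although the
  path \<open>u\<close> itself meets none before its last letter. Leaving that path at position
  \<open>b\<close> therefore forces an occurrence of \<open>u\<close> that starts earlier, say \<open>j > 0\<close> letters before the
  end of \<open>w'\<close>, and which covers the branch point. The last two conjuncts record that \<open>u\<close> and its
  copy shifted by \<open>j\<close> disagree at \<open>b\<close> for the first time; hence \<open>j\<close> determines \<open>b\<close>.
\<close>

lemma branch_overlap: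
  assumes avoid: "\<not> sublist u (w' @ butlast u)"
    and forced: "\<And>v. P v \<Longrightarrow> length v = length w' + length u \<Longrightarrow> sublist u v"
    and branch: "P (w' @ take b u @ [y])" "b < length u" "y \<noteq> u ! b"
  shows "\<exists>j>0. suffix (take j u) w' \<and> j + b < length u \<and>
           u ! (j + b) \<noteq> u ! b \<and> (\<forall>t<b. u ! (j + t) = u ! t)"
proof -
  obtain z' where z': "length z' = length u - b - 1" "P ((w' @ take b u @ [y]) @ z')"
    using extension[OF branch(1)] by blast
  define z where "z = take b u @ [y] @ z'"
  have lz: "length z = length u" using z' branch(2) by (simp add: z_def)
  have zb: "z ! b = y" using branch(2) by (simp add: z_def nth_append)
  have zt: "z ! t = u ! t" if "t < b" for t using branch(2) that by (simp add: z_def nth_append)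
  have "P (w' @ z)" using z' by (simp add: z_def)
  from forced[OF this] lz obtain a c where ac: "w' @ z = a @ u @ c"
    by (auto simp: sublist_def)
  have len: "length w' = length a + length c" using arg_cong[OF ac, of length] lz by simp
  have nz: "z ! t = u ! (length c + t)" if "length c + t < length u" for t
  proof -
    have "z ! t = (w' @ z) ! (length w' + t)" by simp
    also have "\<dots> = (a @ u @ c) ! (length a + (length c + t))" unfolding ac by (simp add: len add.assoc)
    also have "\<dots> = u ! (length c + t)" unfolding nth_append_length_plus using that by (simp add: nth_append)
    finally show ?thesis .
  qed
  have pos: "length c > 0"
    using nz[of b] zb branch by (cases c) auto
  \<comment> \<open>Otherwise the occurrence would be over before the branch point, inside \<open>w' @ butlast u\<close>.\<close>
  have cb: "length c + b < length u"
  proof (rule ccontr)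
    assume *: "\<not> length c + b < length u"
    have "a @ u = take (length a + length u) (a @ u @ c)" by simp
    also have "\<dots> = take (length a + length u) (w' @ z)" by (simp only: ac)
    also have "\<dots> = take (length a + length u) (take (length w' + b) (w' @ z))"
      using * len unfolding take_take by (intro arg_cong2[where f = take] refl) linarith
    also have "take (length w' + b) (w' @ z) = w' @ take b u"
      using branch(2) by (simp add: z_def)
    also have "\<dots> = take (length w' + b) (w' @ butlast u)"
      using branch(2) by (simp add: take_butlast)
    finally have "a @ u = take (min (length a + length u) (length w' + b)) (w' @ butlast u)"
      by (simp only: take_take)
    hence "w' @ butlast u = a @ u @ drop (min (length a + length u) (length w' + b)) (w' @ butlast u)"
      by (metis append.assoc append_take_drop_id)
    with avoid show False unfolding sublist_def by blast
  qed
  have "w' = take (length w') (a @ u @ c)" using ac by (metis append_eq_conv_conj)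
  also have "\<dots> = a @ take (length c) u" using cb by (simp add: len)
  finally have "suffix (take (length c) u) w'" unfolding suffix_def by blast
  moreover have "\<forall>t<b. u ! (length c + t) = u ! t" using nz zt cb by auto
  moreover have "u ! (length c + b) \<noteq> u ! b" using nz[OF cb] zb branch(3) by simp
  ultimately show ?thesis using pos cb by blast
qed

text \<open>
  Let \<open>u\<close> be a long word of the tree and \<open>w\<close> a node that avoids \<open>u\<close> and is as deep as possible;
  recurrence bounds the depth. Any further letter completes an occurrence of \<open>u\<close>, so
  \<open>w = w' @ butlast u\<close>. By \<open>branch_overlap\<close>, distinct branch points on the path from \<open>w'\<close>
  to \<open>w' @ u\<close> yield distinct \<open>j\<close> such that the prefix of \<open>u\<close> of length \<open>j\<close> is a suffix of
  \<open>w'\<close>. Two such \<open>j > C\<close> differ by more than \<open>2 * N\<close>, as their difference is a period of a word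
  of length greater than \<open>C\<close>. So there are at most about \<open>C + length u / (2 * N)\<close> branch points,
  whereas branching within every \<open>N\<close> steps would produce \<open>length u / N\<close> of them.
\<close>

lemma nonbranching_if_no_short_period:
  assumes N: "N > 0"
    and aperiodic: "\<And>v d. \<lbrakk>v \<in> F; C \<le> length v; 0 < d; d \<le> 2 * N\<rbrakk> \<Longrightarrow> \<not> has_period d v"
  shows "\<exists>w z. length z = N \<and> nonbranching w z"
proof (rule ccontr)
  assume contra: "\<not> ?thesis"
  have branches: "\<exists>i<N. \<exists>x. P (w @ take i z @ [x]) \<and> x \<noteq> z ! i" if "length z = N" "P (w @ z)" for w z
    using contra that unfolding nonbranching_def by blast
  \<comment> \<open>This length gives \<open>2 * (C + 2)\<close> blocks of length \<open>N\<close>, but at most \<open>2 * C + 2\<close> overlaps.\<close>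
  define l where "l = 2 * N * (C + 2)"
  obtain u where u: "length u = l" "P u" using extension[OF root, of l] by auto
  have l0: "l > 0" using N by (simp add: l_def)
  obtain R where R: "\<And>w. w \<in> F \<Longrightarrow> R \<le> length w \<Longrightarrow> sublist u w"
    using recurrent[OF in_language[OF u(2)]] by blast
  have "\<exists>w. (P w \<and> \<not> sublist u w) \<and> (\<forall>v. P v \<and> \<not> sublist u v \<longrightarrow> length v \<le> length w)"
  proof (rule ex_has_greatest_nat[where k = "[]" and b = R])
    show "P [] \<and> \<not> sublist u []" using root l0 u(1) by auto
    show "\<forall>y. P y \<and> \<not> sublist u y \<longrightarrow> length y < R" using R in_language not_less by blast
  qed
  then obtain w where w: "P w" "\<not> sublist u w"
    and max: "\<And>v. P v \<Longrightarrow> \<not> sublist u v \<Longrightarrow> length v \<le> length w" by blast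
  obtain x where x: "P (w @ [x])" using child[OF w(1)] by blast
  have "sublist u (w @ [x])" using max[OF x] by auto
  hence "suffix u (w @ [x])" using w(2) by (simp add: sublist_snoc)
  then obtain w' where w': "w @ [x] = w' @ u" unfolding suffix_def by blast
  have weq: "w = w' @ butlast u"
    using arg_cong[OF w', of butlast] u(1) l0 by (auto simp: butlast_append)
  have len: "length w' + length u = Suc (length w)" using arg_cong[OF w', of length] by simp
  have Pu: "P (w' @ u)" using x w' by simp
  define branch_point where "branch_point b \<longleftrightarrow> b < l \<and> (\<exists>y. y \<noteq> u ! b \<and> P (w' @ take b u @ [y]))" for b
  have "\<exists>b. branch_point b \<and> b div N = k" if k: "k < 2 * (C + 2)" for k
  proof -
    have "Suc k * N \<le> 2 * (C + 2) * N" using k by (intro mult_le_mono1) simp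
    hence kN: "k * N + N \<le> l" by (simp add: l_def algebra_simps)
    have split: "take (k * N) u @ take i (take N (drop (k * N) u)) = take (k * N + i) u" if "i \<le> N" for i
      using that by (simp add: take_add min_def)
    have "P (w' @ take (k * N + N) u)"
      using Pu prefix_closed[of "w' @ take (k * N + N) u" "drop (k * N + N) u"] by simp
    hence "P ((w' @ take (k * N) u) @ take N (drop (k * N) u))"
      by (simp add: take_add)
    from branches[OF _ this] obtain i y where
      i: "i < N" "P ((w' @ take (k * N) u) @ take i (take N (drop (k * N) u)) @ [y])"
         "y \<noteq> take N (drop (k * N) u) ! i" using kN u(1) by auto
    have "P (w' @ (take (k * N) u @ take i (take N (drop (k * N) u))) @ [y])"
      using i(2) by (simp only: append.assoc)
    hence "P (w' @ take (k * N + i) u @ [y])" unfolding split[OF less_imp_le[OF i(1)]] .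
    moreover have "y \<noteq> u ! (k * N + i)" using i kN u(1) by simp
    ultimately have "branch_point (k * N + i)" using i(1) kN by (auto simp: branch_point_def)
    thus ?thesis using i(1) N by (intro exI[of _ "k * N + i"]) simp
  qed
  then obtain b where b: "\<And>k. k < 2 * (C + 2) \<Longrightarrow> branch_point (b k) \<and> b k div N = k" by metis
  have "\<exists>j>0. suffix (take j u) w' \<and> j + c < l \<and>
           u ! (j + c) \<noteq> u ! c \<and> (\<forall>t<c. u ! (j + t) = u ! t)" if c: "branch_point c" for c
  proof -
    obtain y where y: "P (w' @ take c u @ [y])" "c < length u" "y \<noteq> u ! c"
      using c u(1) unfolding branch_point_def by auto
    have "sublist u v" if "P v" "length v = length w' + length u" for v
      using max[OF that(1)] that(2) len by fastforce
    from branch_overlap[OF w(2)[unfolded weq] this y] show ?thesis unfolding u(1) .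
  qed
  then obtain j where j: "\<And>c. branch_point c \<Longrightarrow> j c > 0 \<and> suffix (take (j c) u) w' \<and> j c + c < l \<and>
           u ! (j c + c) \<noteq> u ! c \<and> (\<forall>t<c. u ! (j c + t) = u ! t)" by metis
  define J where "J = {i. 0 < i \<and> i < l \<and> suffix (take i u) w'}"
  have finJ: "finite J" unfolding J_def by (rule finite_subset[of _ "{..<l}"]) auto
  \<comment> \<open>The first disagreement of \<open>u\<close> with its copy shifted by \<open>j\<close> recovers the branch point from \<open>j\<close>.\<close>
  have neq: "j (b k) \<noteq> j (b k')" if "k < k'" "k' < 2 * (C + 2)" for k k'
  proof
    assume eq: "j (b k) = j (b k')"
    have k: "k < 2 * (C + 2)" using that by simp
    have "b k div N < b k' div N" using b[OF k] b[OF that(2)] that(1) by simp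
    hence "b k < b k'" by (meson div_le_mono not_less)
    thus False using j[of "b k"] j[of "b k'"] b[OF k] b[OF that(2)] eq by metis
  qed
  hence "inj_on (\<lambda>k. j (b k)) {..<2 * (C + 2)}"
    by (intro inj_onI) (metis lessThan_iff linorder_neqE_nat)
  moreover have "(\<lambda>k. j (b k)) ` {..<2 * (C + 2)} \<subseteq> J"
    using j b unfolding J_def by fastforce
  ultimately have "2 * (C + 2) \<le> card J"
    using card_inj_on_le[OF _ _ finJ] by fastforce
  also have "card J \<le> card ({1..C} \<union> (J \<inter> {C<..}))"
    by (rule card_mono) (use finJ in \<open>auto simp: J_def\<close>)
  also have "\<dots> \<le> C + card (J \<inter> {C<..})" using card_Un_le[of "{1..C}" "J \<inter> {C<..}"] by simp
  \<comment> \<open>Long overlaps in the same block of length \<open>2 * N\<close> would produce a short period.\<close>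
  also have "card (J \<inter> {C<..}) \<le> card {..<C + 2}"
  proof (rule card_inj_on_le[where f = "\<lambda>i. i div (2 * N)"])
    have "i div (2 * N) \<noteq> i' div (2 * N)" if "i \<in> J \<inter> {C<..}" "i' \<in> J \<inter> {C<..}" "i < i'" for i i'
    proof
      assume eq: "i div (2 * N) = i' div (2 * N)"
      have "i' mod (2 * N) < 2 * N" using N by simp
      moreover have "i' = i div (2 * N) * (2 * N) + i' mod (2 * N)"
        unfolding eq by (rule div_mult_mod_eq[symmetric])
      moreover have "i div (2 * N) * (2 * N) \<le> i" by (rule div_times_less_eq_dividend)
      ultimately have "i' - i < 2 * N" by linarith
      moreover have "has_period (i' - i) (take i' u)"
        using that u(1) by (intro overlaps_period[where w = w']) (auto simp: J_def)
      moreover have "take i' u \<in> F"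
        using in_language[OF u(2)] sublist_closed by (meson sublist_take)
      ultimately show False
        using aperiodic[of "take i' u" "i' - i"] that u(1) by (auto simp: J_def)
    qed
    thus "inj_on (\<lambda>i. i div (2 * N)) (J \<inter> {C<..})"
      by (intro inj_onI) (metis linorder_neqE_nat)
    show "(\<lambda>i. i div (2 * N)) ` (J \<inter> {C<..}) \<subseteq> {..<C + 2}"
      using N by (auto simp: J_def l_def less_mult_imp_div_less algebra_simps)
  qed simp
  finally show False by simp
qed

text \<open>
  Periods up to \<open>2 * N\<close> either disappear from all sufficiently long words, or they persist in
  arbitrarily long ones. In the latter case the common multiple \<open>fact (2 * N)\<close> of these periods is
  a period of arbitrarily long words, hence of all words, since each word occurs in every
  sufficiently long one.
\<close>

theorem long_nonbranching_path: "\<exists>w z. length z = N \<and> nonbranching w z"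
proof (cases "N > 0")
  case False
  thus ?thesis using root unfolding nonbranching_def by (intro exI[of _ "[]"]) simp
next
  case True
  show ?thesis
  proof (cases "\<exists>C. \<forall>v\<in>F. \<forall>d. C \<le> length v \<and> 0 < d \<and> d \<le> 2 * N \<longrightarrow> \<not> has_period d v")
    case nonper: True
    thus ?thesis using nonbranching_if_no_short_period[OF True] by meson
  next
    case False
    have "\<exists>v\<in>F. C \<le> length v \<and> has_period (fact (2 * N)) v" for C
    proof -
      obtain v d where v: "v \<in> F" "C \<le> length v" "0 < d" "d \<le> 2 * N" "has_period d v"
        using False by blast
      then obtain k where "fact (2 * N) = k * d"
        using dvd_fact[of d "2 * N"] by (auto simp: dvd_def mult.commute)
      thus ?thesis using v has_period_multiple[OF v(5)] by metis
    qed
    thus ?thesis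
      by (intro nonbranching_if_periodic[of "fact (2 * N)"] periodic_if_long_periodic) auto
  qed
qed

end

section \<open>Finite-dimensional subspaces\<close>

context vector_space
begin

lemma fin_dim_subspace_span: "finite B \<Longrightarrow> fin_dim_subspace (span B)"
  unfolding fin_dim_subspace_def by blast

lemma fin_dim_subspace_basis:
  assumes "fin_dim_subspace L"
  obtains B where "finite B" "independent B" "span B = L" "card B = dim L"
proof -
  obtain C where C: "finite C" "span C = L" using assms unfolding fin_dim_subspace_def by blast
  obtain B where B: "B \<subseteq> L" "independent B" "L \<subseteq> span B" "card B = dim L"
    using basis_exists by blast
  have "finite B" using independent_span_bound[OF C(1) B(2)] B(1) C(2) by blast
  moreover have "span B = L"
    using B span_minimal[OF B(1)] assms unfolding fin_dim_subspace_def by blast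
  ultimately show ?thesis using that B by blast
qed

lemma dim_mono_fin_dim: "\<lbrakk>U \<subseteq> L; fin_dim_subspace L\<rbrakk> \<Longrightarrow> dim U \<le> dim L"
  by (metis dim_le_card fin_dim_subspace_basis)

lemma dim_strict_mono_fin_dim:
  assumes "U \<subset> L" "fin_dim_subspace U" "fin_dim_subspace L"
  shows "dim U < dim L"
proof -
  obtain B where B: "finite B" "independent B" "span B = U" "card B = dim U"
    using fin_dim_subspace_basis[OF assms(2)] by blast
  obtain C where C: "finite C" "span C = L" "card C = dim L"
    using fin_dim_subspace_basis[OF assms(3)] by blast
  obtain a where a: "a \<in> L" "a \<notin> U" using assms(1) by blast
  have "insert a B \<subseteq> span C" using a assms(1) B C span_superset[of B] by auto
  moreover have "independent (insert a B)" using a B independent_insertI by blast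
  ultimately have "card (insert a B) \<le> card C" using independent_span_bound C(1) by blast
  moreover have "a \<notin> B" using a B span_superset[of B] by blast
  ultimately show ?thesis using B C by simp
qed

lemma span_span_Un: "span (span A \<union> span B) = span (A \<union> B)"
  by (simp add: span_Un span_span)

lemma fin_dim_subspace_sum:
  assumes "fin_dim_subspace U" "fin_dim_subspace L"
  shows "fin_dim_subspace (span (U \<union> L))" "dim (span (U \<union> L)) \<le> dim U + dim L"
proof -
  obtain B where B: "finite B" "independent B" "span B = U" "card B = dim U"
    using fin_dim_subspace_basis[OF assms(1)] by blast
  obtain C where C: "finite C" "span C = L" "card C = dim L"
    using fin_dim_subspace_basis[OF assms(2)] by blast
  have eq: "span (U \<union> L) = span (B \<union> C)"
    unfolding B(3)[symmetric] C(2)[symmetric] by (rule span_span_Un)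
  show "fin_dim_subspace (span (U \<union> L))"
    unfolding eq using B C by (intro fin_dim_subspace_span) simp
  have "dim (span (B \<union> C)) \<le> card (B \<union> C)" using B C by (intro dim_le_card) auto
  also have "\<dots> \<le> card B + card C" by (rule card_Un_le)
  finally show "dim (span (U \<union> L)) \<le> dim U + dim L" unfolding eq using B C by simp
qed

lemma fin_dim_subspace_insert:
  assumes "fin_dim_subspace U"
  shows "fin_dim_subspace (span (insert a U))" "dim (span (insert a U)) \<le> Suc (dim U)"
proof -
  have "span U = U" using assms by (simp add: fin_dim_subspace_def span_eq_iff)
  hence eq: "span (insert a U) = span (span {a} \<union> U)"
    using span_span_Un[of "{a}" U] by (simp del: span_eq_iff)
  have fd: "fin_dim_subspace (span {a})" by (rule fin_dim_subspace_span) simp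
  show "fin_dim_subspace (span (insert a U))"
    unfolding eq by (rule fin_dim_subspace_sum(1)[OF fd assms])
  have "dim (span {a}) \<le> 1" using dim_le_card[of "span {a}" "{a}"] by simp
  thus "dim (span (insert a U)) \<le> Suc (dim U)"
    unfolding eq using fin_dim_subspace_sum(2)[OF fd assms] by linarith
qed

end

section \<open>Almost invariant subspaces for actions of letters\<close>

text \<open>
  The word \<open>w\<close> acts by \<open>fold T w\<close>, its first letter first. This is the action on a right module;
  for a left module, \<open>F\<close> consists of the reversed factors.
\<close>

locale letter_action =
  vector_space scale + uniformly_recurrent F
  for scale :: "'k::field \<Rightarrow> 'm::ab_group_add \<Rightarrow> 'm" and F :: "'a list set" +
  fixes T :: "'a \<Rightarrow> 'm \<Rightarrow> 'm"
  assumes T_add: "T x (l + m) = T x l + T x m"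
    and T_scale: "T x (scale r m) = scale r (T x m)"
    and vanish: "w \<notin> F \<Longrightarrow> fold T w m = 0"
    and finite_letters: "finite {x. [x] \<in> F}"
begin

lemma T_zero: "T x 0 = 0"
  using T_scale[of x 0 0] by simp

lemma fold_add: "fold T w (l + m) = fold T w l + fold T w m"
  by (induction w arbitrary: l m) (simp_all add: T_add)

lemma fold_scale: "fold T w (scale r m) = scale r (fold T w m)"
  by (induction w arbitrary: m) (simp_all add: T_scale)

lemma fold_zero: "fold T w 0 = 0"
  by (induction w) (simp_all add: T_zero)

lemma subspace_vimage_T: "subspace U \<Longrightarrow> subspace (T x -` U)"
  unfolding subspace_def by (auto simp: T_add T_scale T_zero)

lemma subspace_vimage_fold: "subspace U \<Longrightarrow> subspace (fold T w -` U)"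
  unfolding subspace_def by (auto simp: fold_add fold_scale fold_zero)

lemma finite_short_words: "finite {w \<in> F. length w \<le> n}"
proof (rule finite_subset)
  show "{w \<in> F. length w \<le> n} \<subseteq> {w. set w \<subseteq> {x. [x] \<in> F} \<and> length w \<le> n}"
  proof (clarsimp)
    fix w x assume "w \<in> F" "x \<in> set w"
    thus "[x] \<in> F" using sublist_closed[of w "[x]"] by (auto simp: sublist_def dest!: split_list)
  qed
qed (rule finite_lists_length_le[OF finite_letters])

definition submodule :: "'m set \<Rightarrow> bool" where
  "submodule S \<longleftrightarrow> subspace S \<and> (\<forall>x. \<forall>m\<in>S. T x m \<in> S)"

lemma submodule_fold: "submodule S \<Longrightarrow> m \<in> S \<Longrightarrow> fold T w m \<in> S"
  by (induction w arbitrary: m) (auto simp: submodule_def)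

text \<open>
  Modulo \<open>S\<close>, each of the first \<open>N\<close> vectors is sent by every letter to a multiple of the next one.
  So each step enlarges the span of \<open>S\<close> and an initial segment of the chain by at most one
  dimension, however many letters there are.
\<close>

definition chain_mod :: "'m set \<Rightarrow> nat \<Rightarrow> (nat \<Rightarrow> 'm) \<Rightarrow> bool" where
  "chain_mod S N f \<longleftrightarrow> f 0 \<notin> S \<and> (\<forall>i<N. \<forall>x. T x (f i) \<in> span (insert (f (Suc i)) S))"

text \<open>
  If some vector outside \<open>S\<close> is sent into \<open>S\<close> by all letters, it starts a chain that continues
  with zeros. Otherwise the words that do not send a given vector into \<open>S\<close> form a leafless tree,
  and a long non-branching path in it is a chain: each letter other than the next one on the path
  sends the current vector into \<open>S\<close>.
\<close>

lemma chain_mod_exists: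
  assumes S: "submodule S" and proper: "S \<noteq> UNIV"
  shows "\<exists>f. chain_mod S N f"
proof (cases "\<exists>m. m \<notin> S \<and> (\<forall>x. T x m \<in> S)")
  case True
  then obtain m where "m \<notin> S" "\<And>x. T x m \<in> S" by blast
  moreover have "0 \<in> S" using S subspace_0 unfolding submodule_def by blast
  ultimately have "chain_mod S N (\<lambda>i. if i = 0 then m else 0)"
    unfolding chain_mod_def by (auto intro!: span_base simp: T_zero)
  thus ?thesis by blast
next
  case False
  obtain m where m: "m \<notin> S" using proper by blast
  have zero: "0 \<in> S" using S subspace_0 unfolding submodule_def by blast
  interpret leafless_subtree F "\<lambda>w. fold T w m \<notin> S"
  proof
    show "w \<in> F" if "fold T w m \<notin> S" for w
      using that vanish zero by metis
  qed (use m S False in \<open>auto simp: submodule_def\<close>)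
  obtain w z where z: "length z = N" and wz: "nonbranching w z"
    using long_nonbranching_path by blast
  define f where "f i = fold T (w @ take i z) m" for i
  have "f 0 \<notin> S"
    using wz prefix_closed[of w z] unfolding f_def nonbranching_def by simp
  moreover have "T x (f i) \<in> span (insert (f (Suc i)) S)" if i: "i < N" for i x
  proof (cases "x = z ! i")
    case True
    hence "T x (f i) = f (Suc i)" using i z by (simp add: f_def take_Suc_conv_app_nth)
    thus ?thesis by (simp add: span_base)
  next
    case False
    hence "fold T (w @ take i z @ [x]) m \<in> S"
      using wz i z unfolding nonbranching_def by blast
    thus ?thesis by (intro span_base) (simp add: f_def)
  qed
  ultimately show ?thesis unfolding chain_mod_def by blast
qed

text \<open>
  Finite-dimensional submodules of large dimension would do with \<open>L' = L\<close>. If their dimensions are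
  bounded, let \<open>S\<close> be one of maximal dimension and take a chain modulo \<open>S\<close>. The spans \<open>\<Lambda> i\<close> of
  \<open>S\<close> and the first vectors of the chain grow by at most one dimension in each step, and also by at
  least one: if \<open>\<Lambda> i = \<Lambda> (Suc i)\<close>, then \<open>\<Lambda> i\<close> would be a finite-dimensional submodule larger
  than \<open>S\<close>. In particular the vectors of the chain are independent without any further argument.
\<close>

lemma unbounded_almost_invariant:
  assumes infinite_dim: "\<not> fin_dim_subspace UNIV"
  shows "\<exists>L L'. fin_dim_subspace L \<and> fin_dim_subspace L' \<and> D \<le> dim L \<and> dim L' \<le> dim L + n \<and>
           (\<forall>w. \<forall>l\<in>L. length w \<le> n \<longrightarrow> fold T w l \<in> L')"
proof (cases "\<exists>S. submodule S \<and> fin_dim_subspace S \<and> D \<le> dim S")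
  case True
  then obtain S where "submodule S" "fin_dim_subspace S" "D \<le> dim S" by blast
  thus ?thesis using submodule_fold by (intro exI[of _ S]) auto
next
  case False
  have "\<exists>S. (submodule S \<and> fin_dim_subspace S) \<and>
          (\<forall>S'. submodule S' \<and> fin_dim_subspace S' \<longrightarrow> dim S' \<le> dim S)"
  proof (rule ex_has_greatest_nat[where k = "{0}" and b = D])
    show "submodule {0} \<and> fin_dim_subspace {0}"
      using fin_dim_subspace_span[of "{}"] by (simp add: submodule_def T_zero)
  qed (use False not_le in blast)
  then obtain S where S: "submodule S" "fin_dim_subspace S"
    and max: "\<And>S'. submodule S' \<Longrightarrow> fin_dim_subspace S' \<Longrightarrow> dim S' \<le> dim S" by blast
  have "S \<noteq> UNIV" using S(2) infinite_dim by auto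
  then obtain f where f: "chain_mod S (D + n) f"
    using chain_mod_exists[OF S(1)] by blast
  define \<Lambda> where "\<Lambda> i = span (S \<union> f ` {..i})" for i
  have Suc_eq: "\<Lambda> (Suc i) = span (insert (f (Suc i)) (\<Lambda> i))" for i
    using span_span_Un[of "{f (Suc i)}" "S \<union> f ` {..i}"] span_span_Un[of "{f (Suc i)}" "\<Lambda> i"]
    unfolding \<Lambda>_def by (simp add: atMost_Suc span_span)
  have fd: "fin_dim_subspace (\<Lambda> i)" for i
  proof (induction i)
    case 0
    thus ?case using fin_dim_subspace_insert(1)[OF S(2), of "f 0"] by (simp add: \<Lambda>_def)
  next
    case (Suc i)
    thus ?case unfolding Suc_eq by (rule fin_dim_subspace_insert(1))
  qed
  have mono: "\<Lambda> i \<subseteq> \<Lambda> j" if "i \<le> j" for i j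
    unfolding \<Lambda>_def using that by (intro span_mono) auto
  have S_sub: "S \<subseteq> \<Lambda> i" for i unfolding \<Lambda>_def by (meson Un_upper1 order_trans span_superset)
  have f_in: "f i \<in> \<Lambda> i" for i unfolding \<Lambda>_def by (simp add: span_base)
  have T_step: "T x l \<in> \<Lambda> (Suc i)" if i: "i < D + n" and l: "l \<in> \<Lambda> i" for x l i
  proof -
    have "S \<union> f ` {..i} \<subseteq> T x -` \<Lambda> (Suc i)"
    proof (intro Un_least subsetI; clarsimp)
      fix m assume "m \<in> S"
      thus "T x m \<in> \<Lambda> (Suc i)" using S(1) S_sub unfolding submodule_def by blast
    next
      fix j assume j: "j \<le> i"
      have "T x (f j) \<in> span (insert (f (Suc j)) S)"
        using f i j unfolding chain_mod_def by auto
      also have "\<dots> \<subseteq> \<Lambda> (Suc j)"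
        unfolding \<Lambda>_def by (intro span_mono) auto
      also have "\<dots> \<subseteq> \<Lambda> (Suc i)" using j by (intro mono) simp
      finally show "T x (f j) \<in> \<Lambda> (Suc i)" .
    qed
    hence "span (S \<union> f ` {..i}) \<subseteq> T x -` \<Lambda> (Suc i)"
      by (intro span_minimal subspace_vimage_T) (simp_all add: \<Lambda>_def)
    thus ?thesis using l unfolding \<Lambda>_def by blast
  qed
  have strict: "dim (\<Lambda> i) < dim (\<Lambda> (Suc i))" if i: "i < D + n" for i
  proof -
    have "\<Lambda> i \<noteq> \<Lambda> (Suc i)"
    proof
      assume "\<Lambda> i = \<Lambda> (Suc i)"
      hence "submodule (\<Lambda> i)"
        using T_step[OF i] unfolding submodule_def by (auto simp: \<Lambda>_def)
      moreover have "S \<subset> \<Lambda> i"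
        using S_sub mono[of 0 i] f_in[of 0] f unfolding chain_mod_def by blast
      ultimately show False
        using max[of "\<Lambda> i"] fd dim_strict_mono_fin_dim[OF _ S(2) fd] by (meson not_le)
    qed
    thus ?thesis using mono[of i "Suc i"] by (intro dim_strict_mono_fin_dim fd) auto
  qed
  have "i \<le> dim (\<Lambda> i)" if "i \<le> D + n" for i
    using that
  proof (induction i)
    case (Suc i)
    thus ?case using strict[of i] by simp
  qed simp
  hence "D \<le> dim (\<Lambda> D)" by simp
  moreover have "dim (\<Lambda> (D + i)) \<le> dim (\<Lambda> D) + i" for i
  proof (induction i)
    case (Suc i)
    thus ?case using fin_dim_subspace_insert(2)[OF fd, of "f (Suc (D + i))" "D + i"] Suc_eq[of "D + i"] by simp
  qed simp
  moreover have "fold T w l \<in> \<Lambda> (i + length w)" if "l \<in> \<Lambda> i" "i + length w \<le> D + n" for w l i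
    using that
  proof (induction w arbitrary: l i)
    case (Cons x w)
    thus ?case using Cons.IH[of "T x l" "Suc i"] T_step[of i l x] by simp
  qed simp
  hence "fold T w l \<in> \<Lambda> (D + n)" if "l \<in> \<Lambda> D" "length w \<le> n" for w l
    using that mono[of "D + length w" "D + n"] by auto
  ultimately show ?thesis
    using fd by (intro exI[of _ "\<Lambda> D"] exI[of _ "\<Lambda> (D + n)"]) simp
qed

text \<open>
  A prescribed \<open>W\<close> can be added to an almost invariant subspace at a cost that does not depend on
  the latter: the words of length at most \<open>n\<close> send \<open>W\<close> into a fixed finite-dimensional \<open>W'\<close>, which
  is negligible once the almost invariant subspace is large. The bound is stated for all subspaces
  \<open>U\<close> of the span because only part of it is used for a given subspace of the algebra.
\<close>

theorem almost_invariant_superspace: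
  fixes m :: 'm
  assumes \<epsilon>: "\<epsilon> > 0" and W: "fin_dim_subspace W" and nontrivial: "m \<noteq> 0"
  shows "\<exists>L. W \<subseteq> L \<and> fin_dim_subspace L \<and>
           (\<forall>U. U \<subseteq> span {fold T w l | w l. length w \<le> n \<and> l \<in> L} \<longrightarrow>
              real (dim U) < (1 + \<epsilon>) * real (dim L))"
proof (cases "fin_dim_subspace UNIV")
  case True
  have "{0} \<subset> (UNIV :: 'm set)" using nontrivial by auto
  hence "dim {0} < dim UNIV"
    using True fin_dim_subspace_span[of "{}"] by (intro dim_strict_mono_fin_dim) auto
  hence pos: "real (dim UNIV) > 0" by simp
  have "real (dim U) < (1 + \<epsilon>) * real (dim UNIV)" for U
  proof -
    have "real (dim U) \<le> real (dim UNIV)" using dim_mono_fin_dim[OF _ True] by simp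
    also have "\<dots> < (1 + \<epsilon>) * real (dim UNIV)" using pos \<epsilon> by (simp add: algebra_simps)
    finally show ?thesis .
  qed
  thus ?thesis using True by blast
next
  case False
  obtain B where B: "finite B" "span B = W" using W unfolding fin_dim_subspace_def by blast
  define W' where "W' = span ((\<lambda>(w, b). fold T w b) ` ({w \<in> F. length w \<le> n} \<times> B))"
  have W': "fin_dim_subspace W'"
    unfolding W'_def using B(1) finite_short_words by (intro fin_dim_subspace_span) simp
  have fold_W: "fold T w l \<in> W'" if "length w \<le> n" "l \<in> W" for w l
  proof (cases "w \<in> F")
    case True
    have "B \<subseteq> fold T w -` W'"
      using True that(1) unfolding W'_def by (auto intro!: span_base)
    hence "span B \<subseteq> fold T w -` W'"
      by (intro span_minimal subspace_vimage_fold) (simp_all add: W'_def)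
    thus ?thesis using that B by blast
  next
    case False
    thus ?thesis using W' vanish subspace_0 unfolding fin_dim_subspace_def by metis
  qed
  \<comment> \<open>The increase \<open>dim W' + n\<close> is less than \<open>\<epsilon> * dim L0\<close> once \<open>dim L0 \<ge> D\<close>.\<close>
  obtain D :: nat where D: "real (dim W' + n) < real D * \<epsilon>"
    using reals_Archimedean3[OF \<epsilon>] by blast
  obtain L0 L' where L0: "fin_dim_subspace L0" "fin_dim_subspace L'" "D \<le> dim L0" "dim L' \<le> dim L0 + n"
    and fold_L0: "\<And>w l. l \<in> L0 \<Longrightarrow> length w \<le> n \<Longrightarrow> fold T w l \<in> L'"
    using unbounded_almost_invariant[OF False] by metis
  define L where "L = span (W \<union> L0)"
  have L: "fin_dim_subspace L" "L0 \<subseteq> L" "W \<subseteq> L"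
    unfolding L_def using fin_dim_subspace_sum(1)[OF W L0(1)] span_superset[of "W \<union> L0"] by auto
  have "fold T w l \<in> span (W' \<union> L')" if "length w \<le> n" "l \<in> L" for w l
  proof -
    have "W \<union> L0 \<subseteq> fold T w -` span (W' \<union> L')"
      using fold_W[OF that(1)] fold_L0[OF _ that(1)] by (auto intro: span_base)
    hence "span (W \<union> L0) \<subseteq> fold T w -` span (W' \<union> L')"
      by (intro span_minimal subspace_vimage_fold) simp_all
    thus ?thesis using that unfolding L_def by blast
  qed
  hence sub: "span {fold T w l | w l. length w \<le> n \<and> l \<in> L} \<subseteq> span (W' \<union> L')"
    by (intro span_minimal) auto
  have "real (dim U) < (1 + \<epsilon>) * real (dim L)"
    if "U \<subseteq> span {fold T w l | w l. length w \<le> n \<and> l \<in> L}" for U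
  proof -
    have "dim U \<le> dim (span (W' \<union> L'))"
      using that sub fin_dim_subspace_sum(1)[OF W' L0(2)] by (meson dim_mono_fin_dim order_trans)
    also have "\<dots> \<le> dim W' + n + dim L0"
      using fin_dim_subspace_sum(2)[OF W' L0(2)] L0(4) by simp
    finally have "real (dim U) \<le> real (dim W' + n) + real (dim L0)" by linarith
    also have "\<dots> < real (dim L0) * \<epsilon> + real (dim L0)"
    proof -
      have "real D * \<epsilon> \<le> real (dim L0) * \<epsilon>"
        using L0(3) \<epsilon> by (intro mult_right_mono) simp_all
      thus ?thesis using D by linarith
    qed
    also have "\<dots> = (1 + \<epsilon>) * real (dim L0)" by (simp add: algebra_simps)
    also have "\<dots> \<le> (1 + \<epsilon>) * real (dim L)"
      using dim_mono_fin_dim[OF L(2,1)] \<epsilon> by simp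
    finally show ?thesis .
  qed
  thus ?thesis using L by blast
qed

end

section \<open>Factors of a minimal subshift\<close>

lemma uniformly_recurrent_reversed:
  assumes "uniformly_recurrent F"
  shows "uniformly_recurrent {w. rev w \<in> F}"
proof -
  interpret uniformly_recurrent F by fact
  show ?thesis
  proof
    fix w v assume "w \<in> {w. rev w \<in> F}" "sublist v w"
    thus "v \<in> {w. rev w \<in> F}" using sublist_closed by simp
  next
    fix u assume "u \<in> {w. rev w \<in> F}"
    then obtain R where "\<forall>w\<in>F. R \<le> length w \<longrightarrow> sublist (rev u) w"
      using recurrent by blast
    thus "\<exists>R. \<forall>w\<in>{w. rev w \<in> F}. R \<le> length w \<longrightarrow> sublist u w"
      by (intro exI[of _ R]) (metis length_rev mem_Collect_eq sublist_rev)
  qed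
qed

definition occurs_at :: "'a list \<Rightarrow> (int \<Rightarrow> 'a) \<Rightarrow> int \<Rightarrow> bool" where
  "occurs_at u x i \<longleftrightarrow> (\<forall>j<length u. u ! j = x (i + int j))"

lemma factors_iff_occurs: "u \<in> factors X \<longleftrightarrow> (\<exists>x\<in>X. \<exists>i. occurs_at u x i)"
  unfolding factors_alt occurs_at_def ..

lemma translate_in_subshift:
  assumes "shift ` X = X" "x \<in> X"
  shows "(\<lambda>k. x (k + m)) \<in> X"
proof (induction m rule: int_induct[where k = 0])
  case base
  show ?case using assms by simp
next
  case (step1 m)
  have "shift (\<lambda>k. x (k + m)) \<in> X" using step1 assms(1) by blast
  thus ?case by (simp add: shift_def algebra_simps)
next
  case (step2 m)
  then obtain y where y: "y \<in> X" "(\<lambda>k. x (k + m)) = shift y" using assms(1) by blast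
  have "x (k + (m - 1)) = y k" for k
    using fun_cong[OF y(2), of "k - 1"] by (simp add: shift_def algebra_simps)
  thus ?case using y(1) by (simp add: fun_eq_iff)
qed

lemma closedin_avoiding:
  fixes \<Sigma> :: "'a set"
  defines "\<T> \<equiv> product_topology (\<lambda>_::int. discrete_topology \<Sigma>) UNIV"
  assumes "closedin \<T> X"
  shows "closedin \<T> {x \<in> X. \<forall>i\<in>I. \<not> occurs_at u x i}"
proof -
  have letter: "openin \<T> {x \<in> topspace \<T>. x k = a}" for k a
  proof -
    have "continuous_map \<T> (discrete_topology \<Sigma>) (\<lambda>x. x k)"
      unfolding \<T>_def by (rule continuous_map_product_projection) simp
    hence "openin \<T> {x \<in> topspace \<T>. x k \<in> \<Sigma> \<inter> {a}}"
      by (rule openin_continuous_map_preimage) simp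
    also have "{x \<in> topspace \<T>. x k \<in> \<Sigma> \<inter> {a}} = {x \<in> topspace \<T>. x k = a}"
      by (auto simp: \<T>_def)
    finally show ?thesis .
  qed
  have occ: "openin \<T> {x \<in> topspace \<T>. occurs_at u x i}" for i
  proof -
    have "openin \<T> ((\<Inter>j<length u. {x \<in> topspace \<T>. x (i + int j) = u ! j}) \<inter> topspace \<T>)"
      by (intro openin_INT letter) simp
    also have "(\<Inter>j<length u. {x \<in> topspace \<T>. x (i + int j) = u ! j}) \<inter> topspace \<T>
        = {x \<in> topspace \<T>. occurs_at u x i}"
      by (auto simp: occurs_at_def)
    finally show ?thesis .
  qed
  have "closedin \<T> (X - (\<Union>i\<in>I. {x \<in> topspace \<T>. occurs_at u x i}))"
    by (intro closedin_diff assms openin_Union) (auto intro: occ)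
  also have "X - (\<Union>i\<in>I. {x \<in> topspace \<T>. occurs_at u x i}) = {x \<in> X. \<forall>i\<in>I. \<not> occurs_at u x i}"
    using closedin_subset[OF assms(2)] by auto
  finally show ?thesis .
qed

lemma sublist_if_occurs:
  assumes "occurs_at w x i" "occurs_at u x (i + int k)" "k + length u \<le> length w"
  shows "sublist u w"
proof -
  have "take (length u) (drop k w) = u"
    using assms by (intro nth_equalityI) (auto simp: occurs_at_def algebra_simps)
  thus ?thesis unfolding sublist_def by (metis append_take_drop_id)
qed

text \<open>
  If \<open>u\<close> is absent from arbitrarily long factors, then, after translation, \<open>X\<close> contains points in
  which \<open>u\<close> does not occur at any position in \<open>{- n..n}\<close>. By compactness some point of \<open>X\<close> avoids
  \<open>u\<close> altogether. The points that avoid \<open>u\<close> then form a subshift, which is all of \<open>X\<close> by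
  minimality, although \<open>u\<close> is a factor of \<open>X\<close>.
\<close>

theorem factors_uniformly_recurrent:
  fixes \<Sigma> :: "'a set"
  assumes fin: "finite \<Sigma>" and min: "minimal_subshift \<Sigma> X"
  shows "uniformly_recurrent (factors X)"
proof
  show "v \<in> factors X" if "w \<in> factors X" "sublist v w" for v w
    using that factors_appendD unfolding sublist_def by metis
next
  fix u assume u: "u \<in> factors X"
  define \<T> where "\<T> = product_topology (\<lambda>_::int. discrete_topology \<Sigma>) UNIV"
  have X: "closedin \<T> X" "shift ` X = X"
    using min unfolding minimal_subshift_def subshift_def \<T>_def by auto
  have least: "Y = X" if "subshift \<Sigma> Y" "Y \<subseteq> X" for Y
    using min that unfolding minimal_subshift_def by blast
  have compact: "compact_space \<T>"
    using fin unfolding \<T>_def by (simp add: compact_space_product_topology compact_space_discrete_topology)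
  show "\<exists>R. \<forall>w\<in>factors X. R \<le> length w \<longrightarrow> sublist u w"
  proof (rule ccontr)
    assume contra: "\<not> ?thesis"
    define C where "C n = {x \<in> X. \<forall>i\<in>{- int n..int n}. \<not> occurs_at u x i}" for n :: nat
    have "closedin \<T> (C n)" for n
      unfolding C_def \<T>_def by (rule closedin_avoiding) (use X in \<open>simp add: \<T>_def\<close>)
    moreover have "C n \<noteq> {}" for n
    proof -
      obtain w where w: "w \<in> factors X" "2 * n + length u \<le> length w" "\<not> sublist u w"
        using contra by blast
      obtain x i where x: "x \<in> X" "occurs_at w x i" using w(1) unfolding factors_iff_occurs by blast
      let ?y = "\<lambda>k. x (k + (i + int n))"
      have "\<not> occurs_at u ?y l" if l: "- int n \<le> l" "l \<le> int n" for l
      proof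
        assume "occurs_at u ?y l"
        hence "occurs_at u x (i + int (nat (l + int n)))"
          using l by (simp add: occurs_at_def algebra_simps)
        moreover have "nat (l + int n) + length u \<le> length w" using l w(2) by linarith
        ultimately show False using sublist_if_occurs[OF x(2)] w(3) by blast
      qed
      moreover have "?y \<in> X" by (rule translate_in_subshift[OF X(2) x(1)])
      ultimately have "?y \<in> C n" unfolding C_def by simp
      thus ?thesis by blast
    qed
    moreover have "decseq C" unfolding C_def decseq_def by auto
    ultimately have "\<Inter>(range C) \<noteq> {}" using compact_space_imp_nest[OF compact] by blast
    then obtain y where y: "\<And>n. y \<in> C n" by blast
    define Y where "Y = {x \<in> X. \<forall>i\<in>UNIV. \<not> occurs_at u x i}"
    have "y \<in> Y"
    proof -
      have "\<not> occurs_at u y i" for i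
        using y[of "nat \<bar>i\<bar>"] abs_ge_self[of i] abs_ge_minus_self[of i] unfolding C_def by fastforce
      thus ?thesis using y[of 0] unfolding Y_def C_def by simp
    qed
    have translate: "(\<lambda>k. x (k + m)) \<in> Y" if "x \<in> Y" for x m
    proof -
      have "occurs_at u x (i + m)" if "occurs_at u (\<lambda>k. x (k + m)) i" for i
        using that by (simp add: occurs_at_def algebra_simps)
      thus ?thesis using that translate_in_subshift[OF X(2)] unfolding Y_def by blast
    qed
    have "shift ` Y = Y"
    proof
      show "shift ` Y \<subseteq> Y" using translate[of _ 1] unfolding shift_def by blast
      show "Y \<subseteq> shift ` Y"
      proof
        fix x assume "x \<in> Y"
        have "x = shift (\<lambda>k. x (k + - 1))" by (simp add: shift_def)
        thus "x \<in> shift ` Y" using translate[OF \<open>x \<in> Y\<close>] by (rule image_eqI)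
      qed
    qed
    moreover have "closedin \<T> Y"
      unfolding Y_def \<T>_def by (rule closedin_avoiding) (use X in \<open>simp add: \<T>_def\<close>)
    ultimately have "subshift \<Sigma> Y" using \<open>y \<in> Y\<close> unfolding subshift_def \<T>_def by blast
    hence "Y = X" by (rule least) (auto simp: Y_def)
    thus False using u unfolding factors_iff_occurs Y_def by blast
  qed
qed

lemma finite_letters_of_subshift:
  assumes "finite \<Sigma>" "subshift \<Sigma> X"
  shows "finite {a. [a] \<in> factors X}"
proof (rule finite_subset[OF _ assms(1)])
  have "X \<subseteq> topspace (product_topology (\<lambda>_. discrete_topology \<Sigma>) UNIV)"
    using assms(2) closedin_subset unfolding subshift_def by blast
  thus "{a. [a] \<in> factors X} \<subseteq> \<Sigma>" by (force simp: factors_alt)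
qed

section \<open>Modules over the monomial algebra\<close>

interpretation words: vector_space word_scale
  by (rule vector_space_word_scale)

text \<open>
  Words that are not factors are sent to \<open>0\<close>, so that \<open>word_mult\<close> holds without side conditions
  and all values lie in the algebra. A module structure says nothing about the action of elements
  outside the algebra.
\<close>

definition word :: "(int \<Rightarrow> 'a) set \<Rightarrow> 'a list \<Rightarrow> ('a list \<Rightarrow>\<^sub>0 'k::field)" where
  "word X w = (if w \<in> factors X then Poly_Mapping.single w 1 else 0)"

lemma word_in_algebra: "word X w \<in> monomial_algebra X"
  by (simp add: word_def monomial_algebra_def)

lemma word_Nil: "X \<noteq> {} \<Longrightarrow> word X [] = monomial_one"
  by (simp add: word_def monomial_one_def Nil_in_factors)

lemma word_mult: "monomial_mult X (word X u) (word X v) = word X (u @ v)"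
  using factors_appendD[of u v X] by (auto simp: word_def monomial_mult_single)

lemma fin_dim_subspace_short_words:
  assumes "words.fin_dim_subspace V" "V \<subseteq> monomial_algebra X"
  shows "\<exists>n. V \<subseteq> words.span {word X w | w. length w \<le> n}"
proof -
  obtain B where B: "finite B" "words.span B = V"
    using assms(1) unfolding words.fin_dim_subspace_def by blast
  let ?K = "\<Union>b\<in>B. Poly_Mapping.keys b"
  have "finite (length ` ?K)" using B(1) by simp
  then obtain n where n: "\<And>w. w \<in> ?K \<Longrightarrow> length w \<le> n"
    using finite_nat_set_iff_bounded_le[of "length ` ?K"] by blast
  have "B \<subseteq> words.span {word X w | w. length w \<le> n}"
  proof
    fix b assume b: "b \<in> B"
    have "word_scale (Poly_Mapping.lookup b w) (word X w) \<in> words.span {word X w | w. length w \<le> n}"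
      if "w \<in> Poly_Mapping.keys b" for w
      using that b n by (intro words.span_scale words.span_base) blast
    moreover have "b = (\<Sum>w\<in>Poly_Mapping.keys b. word_scale (Poly_Mapping.lookup b w) (word X w))"
    proof -
      have "b \<in> monomial_algebra X" using b B(2) words.span_superset[of B] assms(2) by blast
      hence "w \<in> factors X" if "w \<in> Poly_Mapping.keys b" for w
        using that unfolding monomial_algebra_def by blast
      hence "(\<Sum>w\<in>Poly_Mapping.keys b. word_scale (Poly_Mapping.lookup b w) (word X w))
          = (\<Sum>w\<in>Poly_Mapping.keys b. Poly_Mapping.single w (Poly_Mapping.lookup b w))"
        by (intro sum.cong refl) (simp add: word_def word_scale_single)
      thus ?thesis by (simp only: word_expansion[symmetric])
    qed
    ultimately show "b \<in> words.span {word X w | w. length w \<le> n}"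
      by (metis (no_types, lifting) words.span_sum)
  qed
  hence "words.span B \<subseteq> words.span {word X w | w. length w \<le> n}"
    by (intro words.span_minimal) simp_all
  thus ?thesis using B(2) by blast
qed

text \<open>
  A finite-dimensional \<open>V\<close> lies in the span of the words of length at most some \<open>n\<close>, so it suffices
  to control the action of these words, and \<open>almost_invariant_superspace\<close> does that.
\<close>

lemma right_module_exhaustively_amenable:
  fixes X :: "(int \<Rightarrow> 'a) set"
    and scaleM :: "'k::field \<Rightarrow> 'm::ab_group_add \<Rightarrow> 'm" and m :: 'm
  assumes fin: "finite \<Sigma>" and min: "minimal_subshift \<Sigma> X"
    and module: "right_module word_scale (monomial_algebra X) (monomial_mult X) monomial_one scaleM act"
    and m: "m \<noteq> 0"
  shows "right_module.exhaustively_amenable word_scale (monomial_algebra X) scaleM act"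
proof -
  interpret R: right_module word_scale "monomial_algebra X" "monomial_mult X" monomial_one scaleM act
    by (rule module)
  have subshift: "subshift \<Sigma> X" using min unfolding minimal_subshift_def by blast
  define T where "T = (\<lambda>x l. act l (word X [x]))"
  have act_zero: "act l 0 = 0" for l
    using R.act_scale_right[of 0 l 0] words.subspace_0[OF R.subspace_A] by simp
  have fold_T: "fold T w l = act l (word X w)" for w l
  proof (induction w rule: rev_induct)
    case Nil
    show ?case using subshift R.act_one by (simp add: word_Nil subshift_def)
  next
    case (snoc x w)
    thus ?case
      using R.act_mult[OF word_in_algebra word_in_algebra, of l w "[x]"] by (simp add: T_def word_mult)
  qed
  interpret T: letter_action scaleM "factors X" T
  proof (intro letter_action.intro letter_action_axioms.intro)
    show "uniformly_recurrent (factors X)" by (rule factors_uniformly_recurrent[OF fin min])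
    show "finite {x. [x] \<in> factors X}" by (rule finite_letters_of_subshift[OF fin subshift])
    show "fold T w l = 0" if "w \<notin> factors X" for w l
      using that by (simp add: fold_T word_def act_zero)
  qed (auto simp: T_def R.act_add_left R.act_scale_left word_in_algebra intro: R.M.vector_space_axioms)
  show ?thesis
    unfolding R.exhaustively_amenable_def
  proof (intro allI impI; elim conjE)
    fix V :: "('a list \<Rightarrow>\<^sub>0 'k) set" and W and \<epsilon> :: real
    assume V: "words.fin_dim_subspace V" "V \<subseteq> monomial_algebra X" and \<epsilon>: "\<epsilon> > 0"
      and W: "R.M.fin_dim_subspace W"
    obtain n where n: "V \<subseteq> words.span {word X w | w. length w \<le> n}"
      using fin_dim_subspace_short_words[OF V] by blast
    obtain L where L: "W \<subseteq> L" "R.M.fin_dim_subspace L"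
      and small: "\<And>U. U \<subseteq> R.M.span {fold T w l | w l. length w \<le> n \<and> l \<in> L} \<Longrightarrow>
              real (R.M.dim U) < (1 + \<epsilon>) * real (R.M.dim L)"
      using T.almost_invariant_superspace[OF \<epsilon> W m, of n] by blast
    let ?U = "R.M.span {fold T w l | w l. length w \<le> n \<and> l \<in> L}"
    have "act l v \<in> ?U" if "l \<in> L" "v \<in> V" for l v
    proof -
      have "words.subspace {v \<in> monomial_algebra X. act l v \<in> ?U}"
        using R.subspace_A R.M.subspace_span
        by (auto simp: words.subspace_def act_zero R.act_add_right R.act_scale_right
            R.M.span_zero R.M.span_add R.M.span_scale)
      moreover have "{word X w | w. length w \<le> n} \<subseteq> {v \<in> monomial_algebra X. act l v \<in> ?U}"
        using that(1) by (auto simp: word_in_algebra fold_T intro!: R.M.span_base)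
      ultimately have "words.span {word X w | w. length w \<le> n} \<subseteq> {v \<in> monomial_algebra X. act l v \<in> ?U}"
        by (intro words.span_minimal)
      thus ?thesis using that(2) n by blast
    qed
    hence "R.M.span {act l v | l v. l \<in> L \<and> v \<in> V} \<subseteq> ?U"
      by (intro R.M.span_minimal) auto
    from small[OF this] L show "\<exists>L. W \<subseteq> L \<and> R.invariant_subspace V \<epsilon> L"
      unfolding R.invariant_subspace_def by blast
  qed
qed

text \<open>
  On a left module the last letter of a word acts first, so reading words backwards turns the left
  action of the factors into a letter action of the reversed factors.
\<close>

lemma left_module_exhaustively_amenable:
  fixes X :: "(int \<Rightarrow> 'a) set"
    and scaleM :: "'k::field \<Rightarrow> 'm::ab_group_add \<Rightarrow> 'm" and m :: 'm
  assumes fin: "finite \<Sigma>" and min: "minimal_subshift \<Sigma> X"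
    and module: "left_module word_scale (monomial_algebra X) (monomial_mult X) monomial_one scaleM act"
    and m: "m \<noteq> 0"
  shows "left_module.exhaustively_amenable word_scale (monomial_algebra X) scaleM act"
proof -
  interpret N: left_module word_scale "monomial_algebra X" "monomial_mult X" monomial_one scaleM act
    by (rule module)
  have subshift: "subshift \<Sigma> X" using min unfolding minimal_subshift_def by blast
  define T where "T = (\<lambda>x l. act (word X [x]) l)"
  have act_zero: "act 0 l = 0" for l
    using N.act_scale_left[of 0 0 l] words.subspace_0[OF N.subspace_A] by simp
  have fold_T: "fold T w l = act (word X (rev w)) l" for w l
  proof (induction w rule: rev_induct)
    case Nil
    show ?case using subshift N.act_one by (simp add: word_Nil subshift_def)
  next
    case (snoc x w)
    thus ?case
      using N.act_mult[OF word_in_algebra word_in_algebra, of "[x]" "rev w" l] by (simp add: T_def word_mult)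
  qed
  interpret T: letter_action scaleM "{w. rev w \<in> factors X}" T
  proof (intro letter_action.intro letter_action_axioms.intro)
    show "uniformly_recurrent {w. rev w \<in> factors X}"
      by (rule uniformly_recurrent_reversed[OF factors_uniformly_recurrent[OF fin min]])
    show "finite {x. [x] \<in> {w. rev w \<in> factors X}}"
      using finite_letters_of_subshift[OF fin subshift] by simp
    show "fold T w l = 0" if "w \<notin> {w. rev w \<in> factors X}" for w l
      using that by (simp add: fold_T word_def act_zero)
  qed (auto simp: T_def N.act_add_right N.act_scale_right word_in_algebra intro: N.M.vector_space_axioms)
  show ?thesis
    unfolding N.exhaustively_amenable_def
  proof (intro allI impI; elim conjE)
    fix V :: "('a list \<Rightarrow>\<^sub>0 'k) set" and W and \<epsilon> :: real
    assume V: "words.fin_dim_subspace V" "V \<subseteq> monomial_algebra X" and \<epsilon>: "\<epsilon> > 0"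
      and W: "N.M.fin_dim_subspace W"
    obtain n where n: "V \<subseteq> words.span {word X w | w. length w \<le> n}"
      using fin_dim_subspace_short_words[OF V] by blast
    obtain L where L: "W \<subseteq> L" "N.M.fin_dim_subspace L"
      and small: "\<And>U. U \<subseteq> N.M.span {fold T w l | w l. length w \<le> n \<and> l \<in> L} \<Longrightarrow>
              real (N.M.dim U) < (1 + \<epsilon>) * real (N.M.dim L)"
      using T.almost_invariant_superspace[OF \<epsilon> W m, of n] by blast
    let ?U = "N.M.span {fold T w l | w l. length w \<le> n \<and> l \<in> L}"
    have "act v l \<in> ?U" if "l \<in> L" "v \<in> V" for l v
    proof -
      have "words.subspace {v \<in> monomial_algebra X. act v l \<in> ?U}"
        using N.subspace_A N.M.subspace_span
        by (auto simp: words.subspace_def act_zero N.act_add_left N.act_scale_left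
            N.M.span_zero N.M.span_add N.M.span_scale)
      moreover have "act (word X w) l \<in> ?U" if "length w \<le> n" for w
        using that \<open>l \<in> L\<close> fold_T[of "rev w" l]
        by (intro N.M.span_base CollectI exI[of _ "rev w"] exI[of _ l]) simp
      hence "{word X w | w. length w \<le> n} \<subseteq> {v \<in> monomial_algebra X. act v l \<in> ?U}"
        by (auto simp: word_in_algebra)
      ultimately have "words.span {word X w | w. length w \<le> n} \<subseteq> {v \<in> monomial_algebra X. act v l \<in> ?U}"
        by (intro words.span_minimal)
      thus ?thesis using that(2) n by blast
    qed
    hence "N.M.span {act v l | v l. v \<in> V \<and> l \<in> L} \<subseteq> ?U"
      by (intro N.M.span_minimal) auto
    from small[OF this] L show "\<exists>L. W \<subseteq> L \<and> N.invariant_subspace V \<epsilon> L"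
      unfolding N.invariant_subspace_def by blast
  qed
qed

theorem theorem1p1:
  fixes \<Sigma> :: "'a set"
    and X :: "(int \<Rightarrow> 'a) set"
  assumes "finite \<Sigma>"
    and "minimal_subshift \<Sigma> X"
  shows "(\<forall>(scaleM :: 'k::field \<Rightarrow> 'm::ab_group_add \<Rightarrow> 'm) act.
            right_module word_scale (monomial_algebra X) (monomial_mult X) monomial_one scaleM act \<and>
            (\<exists>m :: 'm. m \<noteq> 0) \<longrightarrow>
            right_module.exhaustively_amenable word_scale (monomial_algebra X) scaleM act) \<and>
         (\<forall>(scaleM :: 'k::field \<Rightarrow> 'n::ab_group_add \<Rightarrow> 'n) act.
            left_module word_scale (monomial_algebra X) (monomial_mult X) monomial_one scaleM act \<and>
            (\<exists>m :: 'n. m \<noteq> 0) \<longrightarrow>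
            left_module.exhaustively_amenable word_scale (monomial_algebra X) scaleM act)"
  using right_module_exhaustively_amenable[OF assms] left_module_exhaustively_amenable[OF assms]
  by blast

end
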